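(* Let $\mathcal{R}$ be any relation on processes with $\simeq\;\subseteq\mathcal{R}\subseteq\;\approx$ (branching bisimilarity contained in $\mathcal{R}$, contained in weak bisimilarity). Then the following problem is undecidable: given a normed one counter net and two of its processes $P,Q$, decide whether $P\,\mathcal{R}\,Q$.
   Context: A one counter net is a tuple $(\mathcal{Q},X,\mathcal{A},\Delta)$ where $\mathcal{Q}$ is a finite set of states, $X$ is a place, $\mathcal{A}$ is a finite set of actions containing a special silent action $\tau$, and $\Delta$ is a finite set of rules of the form $pX^{i}\stackrel{\ell}{\longrightarrow}qX^{j}$ with $i\in\{0,1\}$, $j\ge 0$, $\ell\in\mathcal{A}$. Processes are $pX^{n}$ ($p$ a state, $n\ge 0$ the number of tokens). Semantics: $pX^{i+k}\stackrel{\ell}{\longrightarrow}qX^{j+k}$ for all $k\ge0$ whenever $pX^{i}\stackrel{\ell}{\longrightarrow}qX^{j}\in\Delta$. A process $P$ is normed if there are actions $\ell_1,\dots,\ell_m$ and a state $p$ with $P\stackrel{\ell_1}{\longrightarrow}\cdots\stackrel{\ell_m}{\longrightarrow}p$ (i.e. $pX^0$) and $p$ has no outgoing transition; the net is normed if all its processes are normed. Write $\Longrightarrow$ for the reflexive transitive closure of $\stackrel{\tau}{\longrightarrow}$, and $\stackrel{\widehat{\ell}}{\Longrightarrow}$ for $\Longrightarrow\stackrel{\ell}{\longrightarrow}\Longrightarrow$ if $\ell\neq\tau$ and for $\Longrightarrow$ if $\ell=\tau$. A relation $\mathcal{B}$ is a weak bisimulation if whenever $P\mathcal{B}Q$ and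 $P\stackrel{\ell}{\longrightarrow}P'$ there is $Q'$ with $Q\stackrel{\widehat{\ell}}{\Longrightarrow}Q'$ and $P'\mathcal{B}Q'$, and symmetrically for moves of $Q$; $\approx$ is the largest weak bisimulation. A relation $\mathcal{B}$ is a branching bisimulation if whenever $P\mathcal{B}Q$ and $P\stackrel{\ell}{\longrightarrow}P'$, either (i) $Q\Longrightarrow Q''\stackrel{\ell}{\longrightarrow}Q'$ with $P\mathcal{B}Q''$ and $P'\mathcal{B}Q'$, or (ii) $\ell=\tau$ and $P'\mathcal{B}Q$; and symmetrically for moves of $Q$. $\simeq$ is the largest branching bisimulation. *)

theory Defs
  imports Main "HOL-Library.Nat_Bijection"
begin

text \<open>States and actions are natural numbers; the action 0 is the silent action tau.
A rule (p, i, l, q, j) stands for  p X^i --l--> q X^j  with i in {0,1}.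
A net is a pair (Qs, Delta): the finite list of states and the finite list of rules.
A process is a pair (p, n) standing for p X^n.\<close>

type_synonym state = nat
type_synonym action = nat
type_synonym rule = "state \<times> nat \<times> action \<times> state \<times> nat"
type_synonym ocn = "state list \<times> rule list"
type_synonym proc = "state \<times> nat"

definition tau :: action where "tau = 0"

definition states :: "ocn \<Rightarrow> state set" where
  "states N = set (fst N)"

definition rules :: "ocn \<Rightarrow> rule set" where
  "rules N = set (snd N)"

definition wf_ocn :: "ocn \<Rightarrow> bool" where
  "wf_ocn N \<longleftrightarrow> (\<forall>(p, i, l, q, j) \<in> rules N. p \<in> states N \<and> q \<in> states N \<and> i \<le> 1)"

definition step :: "ocn \<Rightarrow> proc \<Rightarrow> action \<Rightarrow> proc \<Rightarrow> bool" where
  "step N P l P' \<longleftrightarrow>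
     (\<exists>p i q j k. (p, i, l, q, j) \<in> rules N \<and> P = (p, i + k) \<and> P' = (q, j + k))"

definition is_process :: "ocn \<Rightarrow> proc \<Rightarrow> bool" where
  "is_process N P \<longleftrightarrow> fst P \<in> states N"

definition normed_proc :: "ocn \<Rightarrow> proc \<Rightarrow> bool" where
  "normed_proc N P \<longleftrightarrow>
     (\<exists>p. (\<lambda>A B. \<exists>l. step N A l B)\<^sup>*\<^sup>* P (p, 0) \<and>
          (\<forall>l P'. \<not> step N (p, 0) l P'))"

definition normed_ocn :: "ocn \<Rightarrow> bool" where
  "normed_ocn N \<longleftrightarrow> (\<forall>P. is_process N P \<longrightarrow> normed_proc N P)"

definition taus :: "ocn \<Rightarrow> proc \<Rightarrow> proc \<Rightarrow> bool" where
  "taus N = (\<lambda>A B. step N A tau B)\<^sup>*\<^sup>*"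

definition weak_step :: "ocn \<Rightarrow> proc \<Rightarrow> action \<Rightarrow> proc \<Rightarrow> bool" where
  "weak_step N P l P' \<longleftrightarrow>
     (if l = tau then taus N P P'
      else (\<exists>P1 P2. taus N P P1 \<and> step N P1 l P2 \<and> taus N P2 P'))"

definition weak_bisimulation :: "ocn \<Rightarrow> (proc \<Rightarrow> proc \<Rightarrow> bool) \<Rightarrow> bool" where
  "weak_bisimulation N B \<longleftrightarrow>
     (\<forall>P Q. B P Q \<longrightarrow>
        (\<forall>l P'. step N P l P' \<longrightarrow> (\<exists>Q'. weak_step N Q l Q' \<and> B P' Q')) \<and>
        (\<forall>l Q'. step N Q l Q' \<longrightarrow> (\<exists>P'. weak_step N P l P' \<and> B P' Q')))"

definition weak_bisim :: "ocn \<Rightarrow> proc \<Rightarrow> proc \<Rightarrow> bool" where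
  "weak_bisim N P Q \<longleftrightarrow> (\<exists>B. weak_bisimulation N B \<and> B P Q)"

definition branching_bisimulation :: "ocn \<Rightarrow> (proc \<Rightarrow> proc \<Rightarrow> bool) \<Rightarrow> bool" where
  "branching_bisimulation N B \<longleftrightarrow>
     (\<forall>P Q. B P Q \<longrightarrow>
        (\<forall>l P'. step N P l P' \<longrightarrow>
           (\<exists>Q'' Q'. taus N Q Q'' \<and> step N Q'' l Q' \<and> B P Q'' \<and> B P' Q') \<or>
           (l = tau \<and> B P' Q)) \<and>
        (\<forall>l Q'. step N Q l Q' \<longrightarrow>
           (\<exists>P'' P'. taus N P P'' \<and> step N P'' l P' \<and> B P'' Q \<and> B P' Q') \<or>
           (l = tau \<and> B P Q')))"

definition branching_bisim :: "ocn \<Rightarrow> proc \<Rightarrow> proc \<Rightarrow> bool" where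
  "branching_bisim N P Q \<longleftrightarrow> (\<exists>B. branching_bisimulation N B \<and> B P Q)"

datatype instr = Inc nat nat | Dec nat nat nat
  \<comment> \<open>Inc r l: increment register r, jump to l;
      Dec r l1 l2: if register r > 0 decrement it and jump to l1, else jump to l2.\<close>

type_synonym config = "nat \<times> (nat \<Rightarrow> nat)"

definition halted :: "instr list \<Rightarrow> config \<Rightarrow> bool" where
  "halted M c \<longleftrightarrow> length M \<le> fst c"

definition mstep :: "instr list \<Rightarrow> config \<Rightarrow> config" where
  "mstep M c = (let (pc, regs) = c in
     if length M \<le> pc then c
     else (case M ! pc of
             Inc r l \<Rightarrow> (l, regs(r := Suc (regs r)))
           | Dec r l1 l2 \<Rightarrow> (if regs r > 0 then (l1, regs(r := regs r - 1)) else (l2, regs))))"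

definition computes :: "instr list \<Rightarrow> nat \<Rightarrow> nat \<Rightarrow> bool" where
  "computes M x y \<longleftrightarrow>
     (\<exists>k. halted M ((mstep M ^^ k) (0, (\<lambda>r. if r = 0 then x else 0))) \<and>
          snd ((mstep M ^^ k) (0, (\<lambda>r. if r = 0 then x else 0))) 0 = y)"

definition encode_rule :: "rule \<Rightarrow> nat" where
  "encode_rule r = (case r of (p, i, l, q, j) \<Rightarrow>
     prod_encode (p, prod_encode (i, prod_encode (l, prod_encode (q, j)))))"

definition encode_ocn :: "ocn \<Rightarrow> nat" where
  "encode_ocn N = prod_encode (list_encode (fst N), list_encode (map encode_rule (snd N)))"

definition encode_instance :: "ocn \<Rightarrow> proc \<Rightarrow> proc \<Rightarrow> nat" where
  "encode_instance N P Q = prod_encode (encode_ocn N, prod_encode (prod_encode P, prod_encode Q))"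

definition valid_instance :: "ocn \<Rightarrow> proc \<Rightarrow> proc \<Rightarrow> bool" where
  "valid_instance N P Q \<longleftrightarrow> wf_ocn N \<and> normed_ocn N \<and> is_process N P \<and> is_process N Q"

definition decidable_on_normed_ocn :: "(ocn \<Rightarrow> proc \<Rightarrow> proc \<Rightarrow> bool) \<Rightarrow> bool" where
  "decidable_on_normed_ocn R \<longleftrightarrow>
     (\<exists>M. \<forall>N P Q. valid_instance N P Q \<longrightarrow>
        computes M (encode_instance N P Q) (if R N P Q then 1 else 0))"

end

theory Submission
  imports Defs "HOL-Computational_Algebra.Primes" "HOL-Library.Infinite_Set"
begin

text \<open>An affine system is a finite graph whose nodes carry a counter: from node \<open>q\<close> with value \<open>n\<close>
one may move to node \<open>nx q k\<close> with value \<open>m\<close> whenever \<open>al q * n + ga q = be q k * m + de q k\<close>.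
Its infinite runs are simulated by the bisimulation game. The process \<open>Holder q\<close> stores \<open>n\<close>, while
\<open>Guesser q\<close> changes its counter freely by silent steps, so that all its processes are branching
bisimilar. When the attacker moves \<open>Holder q\<close> to \<open>Asker q\<close>, the defender must choose \<open>k\<close> and \<open>m\<close>
and move to \<open>Answerer q k\<close>. The attacker may then test the equation by letting both sides count
down, or continue with the \<open>k\<close>-th successor, where the roles of the two sides are exchanged:
\<open>Answerer q k\<close> becomes \<open>Holder (nx q k)\<close> and \<open>Asker q\<close> becomes \<open>Guesser (nx q k)\<close>. A surviving
defender thus yields an infinite run even in the weak game, and an infinite run yields a
branching bisimulation.

With registers stored as exponents of primes, a register machine is such an affine system, so
every machine has a net on which it does not halt iff two processes are related. The net does not
depend on the input; only the number \<open>2 ^ x\<close> of initial tokens does. Hence a decider \<open>M\<close> can be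
diagonalised without any program coding: the machine \<open>diagonal M\<close> regards its input \<open>x\<close> as the
code of a net, builds the instance for that net with \<open>2 ^ x\<close> tokens, runs \<open>M\<close>, and halts iff the
answer is 1. Running it on the code of its own net gives the contradiction.\<close>

section \<open>The net of an affine system\<close>

lemma normed_stepI: "step N P l P' \<Longrightarrow> normed_proc N P' \<Longrightarrow> normed_proc N P"
  unfolding normed_proc_def by (blast intro: converse_rtranclp_into_rtranclp)

lemma taus_stuck: "(\<And>P'. \<not> step N P tau P') \<Longrightarrow> taus N P Q \<longleftrightarrow> Q = P"
  unfolding taus_def by (auto elim: converse_rtranclpE)

lemma weak_bisim_sym:
  assumes "weak_bisim N P Q" shows "weak_bisim N Q P"
proof -
  obtain S where S: "weak_bisimulation N S" "S P Q"
    using assms unfolding weak_bisim_def by auto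
  have "weak_bisimulation N (\<lambda>A B. S B A)"
    unfolding weak_bisimulation_def
  proof (intro allI impI)
    fix P Q
    assume "S Q P"
    then show "(\<forall>l P'. step N P l P' \<longrightarrow> (\<exists>Q'. weak_step N Q l Q' \<and> S Q' P')) \<and>
        (\<forall>l Q'. step N Q l Q' \<longrightarrow> (\<exists>P'. weak_step N P l P' \<and> S Q' P'))"
      using S(1)[unfolded weak_bisimulation_def, rule_format, of Q P] by simp
  qed
  then show ?thesis
    unfolding weak_bisim_def using S(2) by (intro exI[of _ "\<lambda>A B. S B A"]) simp
qed

lemma weak_bisim_step:
  assumes "weak_bisim N P Q" "step N P l P'"
  obtains Q' where "weak_step N Q l Q'" "weak_bisim N P' Q'"
proof -
  obtain S where S: "weak_bisimulation N S" "S P Q"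
    using assms unfolding weak_bisim_def by auto
  then obtain Q' where "weak_step N Q l Q'" "S P' Q'"
    using assms(2) unfolding weak_bisimulation_def by blast
  moreover from this(2) S(1) have "weak_bisim N P' Q'"
    unfolding weak_bisim_def by (intro exI[of _ S]) simp
  ultimately show ?thesis
    using that by blast
qed

section \<open>Controls, affine systems and the rules of the net\<close>

datatype control = Holder nat | Guesser nat | Asker nat | Answerer nat nat | Tally nat nat

fun code :: "control \<Rightarrow> state" where
  "code (Holder q) = prod_encode (0, q)"
| "code (Guesser q) = prod_encode (1, q)"
| "code (Asker q) = prod_encode (2, q)"
| "code (Answerer q k) = prod_encode (3, prod_encode (q, k))"
| "code (Tally a j) = prod_encode (4, prod_encode (a, j))"

lemma code_eq_iff [simp]: "code s = code s' \<longleftrightarrow> s = s'"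
  by (cases s; cases s') (simp_all add: prod_encode_eq)

declare code.simps [simp del]

definition count_act :: action where "count_act = 1"
definition move_act :: action where "move_act = 2"
definition check_act :: action where "check_act = 3"
definition pick_act :: "nat \<Rightarrow> action" where "pick_act k = 4 + k"

lemmas act_defs = tau_def count_act_def move_act_def check_act_def pick_act_def

text \<open>\<open>K\<close> is the number of nodes and \<open>w q\<close> the out-degree of
  \<open>q\<close>. The left-hand coefficients depend on \<open>q\<close> alone because
  \<open>Asker q\<close> is entered before the defender chooses \<open>k\<close>. The common bound
  \<open>B\<close> makes finitely many \<open>Tally\<close> states suffice.\<close>

locale affine_system =
  fixes al ga w :: "nat \<Rightarrow> nat" and be de nx :: "nat \<Rightarrow> nat \<Rightarrow> nat" and K B :: nat
  assumes B_pos: "0 < B"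
    and al: "q < K \<Longrightarrow> 0 < al q \<and> al q \<le> B"
    and ga: "q < K \<Longrightarrow> ga q \<le> B"
    and be: "q < K \<Longrightarrow> k < w q \<Longrightarrow> 0 < be q k \<and> be q k \<le> B"
    and de: "q < K \<Longrightarrow> k < w q \<Longrightarrow> de q k \<le> B"
    and nx: "q < K \<Longrightarrow> k < w q \<Longrightarrow> nx q k < K"
begin

text \<open>Being coinductive, this describes infinite runs only: a run that gets stuck does not
  count.\<close>

coinductive survives :: "nat \<Rightarrow> nat \<Rightarrow> bool" where
  "k < w q \<Longrightarrow> al q * n + ga q = be q k * m + de q k \<Longrightarrow> survives (nx q k) m \<Longrightarrow> survives q n"

definition controls :: "control set" where
  "controls = Holder ` {..<K} \<union> Guesser ` {..<K} \<union> Asker ` {..<K} \<union>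
     (\<Union>q<K. Answerer q ` {..<w q}) \<union> (\<Union>a\<in>{0<..B}. Tally a ` {..B})"

text \<open>The check rule of \<open>Guesser q\<close> only serves to make its processes normed.\<close>

definition move_rules :: "nat \<Rightarrow> rule set" where
  "move_rules q =
     {(code (Holder q), 0, tau, code (Guesser q), 0),
      (code (Holder q), 0, move_act, code (Asker q), 0),
      (code (Guesser q), 0, tau, code (Guesser q), 1),
      (code (Guesser q), 1, tau, code (Guesser q), 0),
      (code (Guesser q), 0, check_act, code (Tally 1 0), 0),
      (code (Asker q), 0, check_act, code (Tally (al q) (ga q)), 0)}"

text \<open>The last family covers a pick of an index other than the defender's \<open>k\<close>:
  both sides then enter the same \<open>Guesser\<close>, whose processes are all bisimilar, so the
  attacker gains nothing by it.\<close>

definition answer_rules :: "nat \<Rightarrow> nat \<Rightarrow> rule set" where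
  "answer_rules q k =
     {(code (Guesser q), 0, move_act, code (Answerer q k), 0),
      (code (Answerer q k), 0, check_act, code (Tally (be q k) (de q k)), 0),
      (code (Asker q), 0, pick_act k, code (Guesser (nx q k)), 0),
      (code (Answerer q k), 0, pick_act k, code (Holder (nx q k)), 0)} \<union>
     (\<lambda>j. (code (Answerer q k), 0, pick_act j, code (Guesser (nx q j)), 0)) ` ({..<w q} - {k})"

text \<open>With \<open>n\<close> tokens, \<open>Tally a j\<close> performs exactly \<open>a * n + j\<close> count actions.\<close>

definition tally_rules :: "nat \<Rightarrow> rule set" where
  "tally_rules a = insert (code (Tally a 0), 1, count_act, code (Tally a (a - 1)), 0)
     ((\<lambda>j. (code (Tally a (Suc j)), 0, count_act, code (Tally a j), 0)) ` {..<B})"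

definition net_rules :: "rule set" where
  "net_rules = (\<Union>q<K. move_rules q \<union> (\<Union>k<w q. answer_rules q k)) \<union> (\<Union>a\<in>{0<..B}. tally_rules a)"

text \<open>Any enumeration of the two finite sets will do, since the diagonal argument only uses
  that the net has some code.\<close>

definition net :: ocn where
  "net = (SOME N. states N = code ` controls \<and> rules N = net_rules)"

lemma net: "states net = code ` controls" "rules net = net_rules"
proof -
  have "finite (code ` controls)" "finite net_rules"
    by (auto simp: controls_def net_rules_def move_rules_def answer_rules_def tally_rules_def)
  then obtain xs rs where "set xs = code ` controls" "set rs = net_rules"
    by (meson finite_list)
  then have "\<exists>N. states N = code ` controls \<and> rules N = net_rules"
    by (intro exI[of _ "(xs, rs)"]) (simp add: states_def rules_def)
  then show "states net = code ` controls" "rules net = net_rules"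
    unfolding net_def by (metis (mono_tags, lifting) someI_ex)+
qed

lemmas rule_defs = net_rules_def move_rules_def answer_rules_def tally_rules_def

section \<open>Transitions of the net, control by control\<close>

lemma step_net: "step net (s, n) l P' \<longleftrightarrow>
    (\<exists>q j. (s, 0, l, q, j) \<in> net_rules \<and> P' = (q, j + n)) \<or>
    (\<exists>m q j. n = Suc m \<and> (s, Suc 0, l, q, j) \<in> net_rules \<and> P' = (q, j + m))" (is "?L \<longleftrightarrow> ?R")
proof
  assume ?L
  then obtain i q j k where "(s, i, l, q, j) \<in> net_rules" "n = i + k" "P' = (q, j + k)"
    unfolding step_def net by auto
  moreover from this(1) have "i = 0 \<or> i = Suc 0"
    by (auto simp: rule_defs)
  ultimately show ?R
    by auto
next
  assume ?R
  then show ?L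
    unfolding step_def net by (metis add_0 add_Suc)
qed

lemma rules_holder: "(code (Holder q), i, l, r) \<in> net_rules \<longleftrightarrow>
    q < K \<and> i = 0 \<and> (l = tau \<and> r = (code (Guesser q), 0) \<or> l = move_act \<and> r = (code (Asker q), 0))"
  by (auto simp: rule_defs)

lemma rules_guesser: "(code (Guesser q), i, l, r) \<in> net_rules \<longleftrightarrow>
    q < K \<and> (i = 0 \<and> l = tau \<and> r = (code (Guesser q), 1) \<or>
             i = 1 \<and> l = tau \<and> r = (code (Guesser q), 0) \<or>
             i = 0 \<and> l = check_act \<and> r = (code (Tally 1 0), 0) \<or>
             i = 0 \<and> l = move_act \<and> (\<exists>k<w q. r = (code (Answerer q k), 0)))"
  by (auto simp: rule_defs)

lemma rules_asker: "(code (Asker q), i, l, r) \<in> net_rules \<longleftrightarrow>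
    q < K \<and> i = 0 \<and> (l = check_act \<and> r = (code (Tally (al q) (ga q)), 0) \<or>
             (\<exists>k<w q. l = pick_act k \<and> r = (code (Guesser (nx q k)), 0)))"
  by (auto simp: rule_defs)

definition reply :: "nat \<Rightarrow> nat \<Rightarrow> nat \<Rightarrow> control" where
  "reply q k j = (if j = k then Holder (nx q j) else Guesser (nx q j))"

lemma rules_answerer: "(code (Answerer q k), i, l, r) \<in> net_rules \<longleftrightarrow>
    q < K \<and> k < w q \<and> i = 0 \<and> (l = check_act \<and> r = (code (Tally (be q k) (de q k)), 0) \<or>
        (\<exists>j<w q. l = pick_act j \<and> r = (code (reply q k j), 0)))"
  by (auto simp: rule_defs reply_def split: if_splits)

lemma rules_tally: "(code (Tally a j), i, l, r) \<in> net_rules \<longleftrightarrow>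
    0 < a \<and> a \<le> B \<and> l = count_act \<and>
      (j = 0 \<and> i = 1 \<and> r = (code (Tally a (a - 1)), 0) \<or>
       0 < j \<and> j \<le> B \<and> i = 0 \<and> r = (code (Tally a (j - 1)), 0))"
  by (cases j) (auto simp: rule_defs image_iff)

lemma step_holder: "step net (code (Holder q), n) l P' \<longleftrightarrow>
    q < K \<and> (l = tau \<and> P' = (code (Guesser q), n) \<or> l = move_act \<and> P' = (code (Asker q), n))"
  unfolding step_net by (auto simp: rules_holder)

lemma step_guesser: "step net (code (Guesser q), n) l P' \<longleftrightarrow>
    q < K \<and> (l = tau \<and> P' = (code (Guesser q), Suc n) \<or>
             l = tau \<and> 0 < n \<and> P' = (code (Guesser q), n - 1) \<or>
             l = check_act \<and> P' = (code (Tally 1 0), n) \<or>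
             l = move_act \<and> (\<exists>k<w q. P' = (code (Answerer q k), n)))"
  unfolding step_net rules_guesser by (cases n) auto

lemma step_asker: "step net (code (Asker q), n) l P' \<longleftrightarrow>
    q < K \<and> (l = check_act \<and> P' = (code (Tally (al q) (ga q)), n) \<or>
             (\<exists>k<w q. l = pick_act k \<and> P' = (code (Guesser (nx q k)), n)))"
  unfolding step_net rules_asker by auto

lemma step_answerer: "step net (code (Answerer q k), n) l P' \<longleftrightarrow>
    q < K \<and> k < w q \<and> (l = check_act \<and> P' = (code (Tally (be q k) (de q k)), n) \<or>
        (\<exists>j<w q. l = pick_act j \<and> P' = (code (reply q k j), n)))"
  unfolding step_net rules_answerer by auto

lemma step_tally: "step net (code (Tally a j), n) l P' \<longleftrightarrow>
    0 < a \<and> a \<le> B \<and> l = count_act \<and>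
      (j = 0 \<and> 0 < n \<and> P' = (code (Tally a (a - 1)), n - 1) \<or>
       0 < j \<and> j \<le> B \<and> P' = (code (Tally a (j - 1)), n))"
  unfolding step_net rules_tally by (cases n; cases j) auto

section \<open>Well-formedness and normedness of the net\<close>

lemma states_net:
  "code (Holder q) \<in> states net \<longleftrightarrow> q < K"
  "code (Guesser q) \<in> states net \<longleftrightarrow> q < K"
  "code (Asker q) \<in> states net \<longleftrightarrow> q < K"
  "code (Answerer q k) \<in> states net \<longleftrightarrow> q < K \<and> k < w q"
  "code (Tally a j) \<in> states net \<longleftrightarrow> 0 < a \<and> a \<le> B \<and> j \<le> B"
proof -
  have "code c \<in> code ` controls \<longleftrightarrow> c \<in> controls" for c
    by auto
  then show
    "code (Holder q) \<in> states net \<longleftrightarrow> q < K"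
    "code (Guesser q) \<in> states net \<longleftrightarrow> q < K"
    "code (Asker q) \<in> states net \<longleftrightarrow> q < K"
    "code (Answerer q k) \<in> states net \<longleftrightarrow> q < K \<and> k < w q"
    "code (Tally a j) \<in> states net \<longleftrightarrow> 0 < a \<and> a \<le> B \<and> j \<le> B"
    unfolding net by (auto simp: controls_def)
qed

lemma wf_net: "wf_ocn net"
proof -
  have "a - Suc 0 \<le> B" if "a \<le> B" for a
    using that by simp
  then show ?thesis
    unfolding wf_ocn_def net(2)
    using B_pos al ga be de nx by (auto simp: rule_defs states_net Suc_le_eq)
qed

text \<open>Each step lowers \<open>a * n + j\<close> by one; as \<open>a\<close> is positive, the
  value 0 leaves no tokens and no step.\<close>

lemma normed_tally:
  assumes "0 < a" "a \<le> B" "j \<le> B"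
  shows "normed_proc net (code (Tally a j), n)"
  using assms(3)
proof (induction "a * n + j" arbitrary: n j rule: less_induct)
  case less
  consider "j = 0" "n = 0" | "j = 0" "0 < n" | "0 < j"
    by blast
  then show ?case
  proof cases
    case 1
    then show ?thesis
      unfolding normed_proc_def by (auto simp: step_tally)
  next
    case 2
    then obtain m where "n = Suc m"
      by (cases n) auto
    with less(1)[of m "a - 1"] 2 assms have "normed_proc net (code (Tally a (a - 1)), n - 1)"
      by simp
    then show ?thesis
      by (rule normed_stepI[rotated]) (use 2 assms in \<open>auto simp: step_tally\<close>)
  next
    case 3
    with less(1)[of n "j - 1"] less(2) have "normed_proc net (code (Tally a (j - 1)), n)"
      by simp
    then show ?thesis
      by (rule normed_stepI[rotated]) (use 3 assms less(2) in \<open>auto simp: step_tally\<close>)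
  qed
qed

text \<open>Every control has a check action into a tally, \<open>Holder\<close> after one silent
  step to \<open>Guesser\<close>.\<close>

lemma normed_net: "normed_ocn net"
proof -
  have asker: "normed_proc net (code (Asker q), n)" if "q < K" for q n
    by (rule normed_stepI[where l = check_act, OF _ normed_tally[of "al q" "ga q"]])
      (use that al[of q] ga[of q] in \<open>auto simp: step_asker\<close>)
  have answerer: "normed_proc net (code (Answerer q k), n)" if "q < K" "k < w q" for q k n
    by (rule normed_stepI[where l = check_act, OF _ normed_tally[of "be q k" "de q k"]])
      (use that be[of q k] de[of q k] in \<open>auto simp: step_answerer\<close>)
  have guesser: "normed_proc net (code (Guesser q), n)" if "q < K" for q n
    by (rule normed_stepI[where l = check_act, OF _ normed_tally[of 1 0]])
      (use that B_pos in \<open>auto simp: step_guesser\<close>)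
  have holder: "normed_proc net (code (Holder q), n)" if "q < K" for q n
    by (rule normed_stepI[where l = tau, OF _ guesser[of q]])
      (use that in \<open>auto simp: step_holder\<close>)
  show ?thesis
    unfolding normed_ocn_def
  proof (intro allI impI)
    fix P
    assume "is_process net P"
    then obtain c n where P: "P = (code c, n)" "c \<in> controls"
      unfolding is_process_def net by (cases P) auto
    then show "normed_proc net P"
      using asker answerer guesser holder normed_tally unfolding P(1)
      by (cases c) (auto simp: controls_def)
  qed
qed

section \<open>Silent moves, and the branching bisimulation given by infinite runs\<close>

lemma taus_guesser:
  assumes "q < K" shows "taus net (code (Guesser q), m) (code (Guesser q), n)"
proof -
  have up: "taus net (code (Guesser q), m) (code (Guesser q), m + d)" for m d
    unfolding taus_def
    by (induction d) (auto intro: rtranclp.rtrancl_into_rtrancl simp: step_guesser assms)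
  have down: "taus net (code (Guesser q), m + d) (code (Guesser q), m)" for m d
    unfolding taus_def
    by (induction d) (auto intro: converse_rtranclp_into_rtranclp simp: step_guesser assms)
  show ?thesis
    using up[of m "n - m"] down[of n "m - n"] by (cases "m \<le> n") auto
qed

lemma taus_guesser_iff:
  assumes "q < K" shows "taus net (code (Guesser q), m) P \<longleftrightarrow> (\<exists>n. P = (code (Guesser q), n))"
proof
  show "taus net (code (Guesser q), m) P \<Longrightarrow> \<exists>n. P = (code (Guesser q), n)"
    unfolding taus_def
    by (induction rule: rtranclp_induct) (auto simp: step_guesser act_defs)
qed (use taus_guesser assms in auto)

lemma taus_asker: "taus net (code (Asker q), n) P \<longleftrightarrow> P = (code (Asker q), n)"
  and taus_answerer: "taus net (code (Answerer q k), n) P \<longleftrightarrow> P = (code (Answerer q k), n)"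
  and taus_tally: "taus net (code (Tally a j), n) P \<longleftrightarrow> P = (code (Tally a j), n)"
  by (rule taus_stuck; simp add: step_asker step_answerer step_tally act_defs)+

text \<open>The candidate branching bisimulation. Pairs of \<open>Asker\<close> and
  \<open>Answerer\<close> are the correct answers of the defender; pairs of tallies have equally
  many counts left. Both orientations are included so that only one half of the transfer condition
  has to be checked.\<close>

inductive related :: "proc \<Rightarrow> proc \<Rightarrow> bool" where
  refl: "related P P"
| guessers: "q < K \<Longrightarrow> related (code (Guesser q), m) (code (Guesser q), n)"
| holder: "q < K \<Longrightarrow> survives q n \<Longrightarrow> related (code (Holder q), n) (code (Guesser q), m)"
| holder': "q < K \<Longrightarrow> survives q n \<Longrightarrow> related (code (Guesser q), m) (code (Holder q), n)"
| asker: "q < K \<Longrightarrow> k < w q \<Longrightarrow> al q * n + ga q = be q k * m + de q k \<Longrightarrow> survives (nx q k) m \<Longrightarrow>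
    related (code (Asker q), n) (code (Answerer q k), m)"
| asker': "q < K \<Longrightarrow> k < w q \<Longrightarrow> al q * n + ga q = be q k * m + de q k \<Longrightarrow> survives (nx q k) m \<Longrightarrow>
    related (code (Answerer q k), m) (code (Asker q), n)"
| tally: "0 < a \<Longrightarrow> a \<le> B \<Longrightarrow> 0 < b \<Longrightarrow> b \<le> B \<Longrightarrow> i \<le> B \<Longrightarrow> j \<le> B \<Longrightarrow> a * n + i = b * m + j \<Longrightarrow>
    related (code (Tally a i), n) (code (Tally b j), m)"

lemma related_sym: "related P Q \<Longrightarrow> related Q P"
  by (induction rule: related.induct) (auto intro: related.intros)

lemma tally_stepD:
  assumes "step net (code (Tally a i), n) l P'" "0 < a" "a \<le> B" "i \<le> B"
  obtains i' n' where "P' = (code (Tally a i'), n')" "i' \<le> B" "Suc (a * n' + i') = a * n + i" "l = count_act"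
  using assms by (cases n) (auto simp: step_tally)

lemma tally_step_ex:
  assumes "0 < a * n + i" "0 < a" "a \<le> B" "i \<le> B"
  shows "\<exists>P'. step net (code (Tally a i), n) count_act P'"
  using assms by (cases "i = 0") (auto simp: step_tally)

lemma related_tally_step:
  assumes ab: "0 < a" "a \<le> B" "0 < b" "b \<le> B" "i \<le> B" "j \<le> B" and eq: "a * n + i = b * m + j"
    and step: "step net (code (Tally a i), n) l P'"
  shows "\<exists>Q'. step net (code (Tally b j), m) l Q' \<and> related P' Q'"
proof -
  obtain i' n' where P': "P' = (code (Tally a i'), n')" "i' \<le> B" "Suc (a * n' + i') = a * n + i"
    and l: "l = count_act"
    using tally_stepD[OF step] ab by metis
  then obtain Q' where Q': "step net (code (Tally b j), m) l Q'"
    using tally_step_ex[of b m j] ab eq by fastforce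
  then obtain j' m' where "Q' = (code (Tally b j'), m')" "j' \<le> B" "Suc (b * m' + j') = b * m + j"
    using tally_stepD[OF Q'] ab by metis
  with P' Q' ab eq show ?thesis
    by (intro exI[of _ Q']) (auto intro!: tally)
qed

lemma related_step:
  assumes "related P Q" "step net P l P'"
  shows "(\<exists>Q'' Q'. taus net Q Q'' \<and> step net Q'' l Q' \<and> related P Q'' \<and> related P' Q') \<or>
    l = tau \<and> related P' Q"
  using assms
proof cases
  case refl
  then show ?thesis
    using assms(2) related.refl unfolding taus_def by blast
next
  case (guessers q m n)
  then show ?thesis
    using assms(2) taus_guesser[of q n m] related.refl by blast
next
  case (holder q n m)
  consider "l = tau" "P' = (code (Guesser q), n)" | "l = move_act" "P' = (code (Asker q), n)"
    using assms(2) unfolding holder step_holder by blast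
  then show ?thesis
  proof cases
    case 1
    then show ?thesis
      using holder related.guessers by blast
  next
    case 2
    \<comment> \<open>The infinite run supplies the answer: the \<open>Guesser\<close> first
      silently sets its counter to \<open>m'\<close>, then commits to \<open>k\<close>.\<close>
    obtain k m' where k: "k < w q" "al q * n + ga q = be q k * m' + de q k" "survives (nx q k) m'"
      using \<open>survives q n\<close> by (cases rule: survives.cases) auto
    show ?thesis
      using 2 holder k taus_guesser[of q m m'] related.holder[of q n m'] related.asker[OF _ k]
      by (intro disjI1 exI[of _ "(code (Guesser q), m')"] exI[of _ "(code (Answerer q k), m')"])
        (auto simp: step_guesser)
  qed
next
  case (holder' q n m)
  \<comment> \<open>The \<open>Holder\<close> falls silently to its \<open>Guesser\<close> and
    adjusts the counter until it equals \<open>P\<close>, from where it copies any move.\<close>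
  have "taus net Q (code (Guesser q), m)"
    using taus_guesser[of q n m] holder' unfolding taus_def
    by (auto simp: step_holder intro: converse_rtranclp_into_rtranclp)
  then show ?thesis
    using assms(2) holder' related.refl by blast
next
  case (asker q k n m)
  consider "l = check_act" "P' = (code (Tally (al q) (ga q)), n)"
    | j where "j < w q" "l = pick_act j" "P' = (code (Guesser (nx q j)), n)"
    using assms(2) unfolding asker step_asker by blast
  then have "\<exists>Q'. step net Q l Q' \<and> related P' Q'"
  proof cases
    case 1
    then show ?thesis
      using asker al ga be de by (intro exI[of _ "(code (Tally (be q k) (de q k)), m)"]) (auto simp: step_answerer intro!: tally)
  next
    case 2
    then show ?thesis
      using asker nx by (intro exI[of _ "(code (reply q k j), m)"])
       (auto simp: step_answerer reply_def intro!: related.holder' related.guessers)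
  qed
  then show ?thesis
    using assms(1) unfolding taus_def by blast
next
  case (asker' q k n m)
  consider "l = check_act" "P' = (code (Tally (be q k) (de q k)), m)"
    | j where "j < w q" "l = pick_act j" "P' = (code (reply q k j), m)"
    using assms(2) unfolding asker' step_answerer by blast
  then have "\<exists>Q'. step net Q l Q' \<and> related P' Q'"
  proof cases
    case 1
    then show ?thesis
      using asker' al ga be de by (intro exI[of _ "(code (Tally (al q) (ga q)), n)"]) (auto simp: step_asker intro!: tally)
  next
    case 2
    then show ?thesis
      using asker' nx by (intro exI[of _ "(code (Guesser (nx q j)), n)"])
       (auto simp: step_asker reply_def intro!: related.holder related.guessers)
  qed
  then show ?thesis
    using assms(1) unfolding taus_def by blast
next
  case (tally a b i j n m)
  then have "\<exists>Q'. step net Q l Q' \<and> related P' Q'"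
    using related_tally_step assms(2) by blast
  then show ?thesis
    using assms(1) unfolding taus_def by blast
qed

lemma survives_imp_branching_bisim:
  assumes "q < K" "survives q n"
  shows "branching_bisim net (code (Holder q), n) (code (Guesser q), m)"
proof -
  have "branching_bisimulation net related"
    unfolding branching_bisimulation_def
    using related_step related_sym by meson
  then show ?thesis
    unfolding branching_bisim_def using related.holder assms by blast
qed

section \<open>From weak bisimilarity to an infinite run\<close>

lemma weak_step_tally: "weak_step net (code (Tally a i), n) count_act Q' \<Longrightarrow> 0 < a \<Longrightarrow> a \<le> B \<Longrightarrow> i \<le> B \<Longrightarrow>
    step net (code (Tally a i), n) count_act Q'"
  unfolding weak_step_def
  by (auto simp: tau_def count_act_def taus_tally) (metis taus_tally tally_stepD)

text \<open>Tallies have no silent moves, so even weakly bisimilar ones must perform equally many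
  count actions; the induction is on that number.\<close>

lemma weak_bisim_tally:
  assumes "weak_bisim net (code (Tally a i), n) (code (Tally b j), m)"
    and ab: "0 < a" "a \<le> B" "0 < b" "b \<le> B" and "i \<le> B" "j \<le> B"
  shows "a * n + i = b * m + j"
  using assms(1,6,7)
proof (induction "a * n + i" arbitrary: i n j m)
  case 0
  have "\<not> 0 < b * m + j"
  proof
    assume pos: "0 < b * m + j"
    obtain Q' where "step net (code (Tally b j), m) count_act Q'"
      using tally_step_ex[OF pos ab(3,4) 0(4)] by auto
    then obtain P' where "weak_step net (code (Tally a i), n) count_act P'"
      by (rule weak_bisim_step[OF weak_bisim_sym[OF 0(2)]])
    then have "step net (code (Tally a i), n) count_act P'"
      using weak_step_tally ab 0(3) by simp
    then show False
      by (rule tally_stepD) (use ab 0 in auto)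
  qed
  then show ?case
    using 0(1) by linarith
next
  case (Suc t)
  obtain P' where P': "step net (code (Tally a i), n) count_act P'"
    using tally_step_ex[OF _ ab(1,2) Suc(4), of n] Suc(2)[symmetric] by auto
  then obtain Q' where Q': "weak_step net (code (Tally b j), m) count_act Q'" "weak_bisim net P' Q'"
    by (rule weak_bisim_step[OF Suc(3)])
  from Q'(1) have "step net (code (Tally b j), m) count_act Q'"
    using weak_step_tally ab Suc(5) by simp
  then obtain j' m' where j: "Q' = (code (Tally b j'), m')" "j' \<le> B" "Suc (b * m' + j') = b * m + j"
    by (rule tally_stepD) (use ab Suc(5) in auto)
  from P' obtain i' n' where i: "P' = (code (Tally a i'), n')" "i' \<le> B" "Suc (a * n' + i') = a * n + i"
    by (rule tally_stepD) (use ab Suc(4) in auto)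
  have "a * n' + i' = b * m' + j'"
    by (rule Suc(1)) (use Suc(2) i j Q'(2) in auto)
  then show ?case
    using i j by simp
qed

text \<open>One round of the game (move, check, pick) extracts one step of the run. The coinduction
  invariant leaves the counter of the \<open>Guesser\<close> existential, since silent moves can
  change it after every round.\<close>

lemma weak_bisim_imp_survives:
  assumes "weak_bisim net (code (Holder q), n) (code (Guesser q), m)" "q < K"
  shows "survives q n"
proof -
  have "q < K \<and> (\<exists>m. weak_bisim net (code (Holder q), n) (code (Guesser q), m))"
    using assms by blast
  then show ?thesis
  proof (coinduction arbitrary: q n)
    case survives
    then obtain m where q: "q < K" and bis: "weak_bisim net (code (Holder q), n) (code (Guesser q), m)"
      by blast
    have "step net (code (Holder q), n) move_act (code (Asker q), n)"
      using q by (simp add: step_holder)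
    then obtain Q where "weak_step net (code (Guesser q), m) move_act Q"
      and Q: "weak_bisim net (code (Asker q), n) Q"
      by (rule weak_bisim_step[OF bis])
    then obtain k m' where k: "k < w q" and "taus net (code (Answerer q k), m') Q"
      using q unfolding weak_step_def
      by (auto simp: taus_guesser_iff step_guesser act_defs)
    with Q have bis': "weak_bisim net (code (Asker q), n) (code (Answerer q k), m')"
      by (simp add: taus_answerer)
    have "step net (code (Asker q), n) check_act (code (Tally (al q) (ga q)), n)"
      using q by (simp add: step_asker)
    then obtain Q1 where "weak_step net (code (Answerer q k), m') check_act Q1"
      and "weak_bisim net (code (Tally (al q) (ga q)), n) Q1"
      by (rule weak_bisim_step[OF bis'])
    then have "weak_bisim net (code (Tally (al q) (ga q)), n) (code (Tally (be q k) (de q k)), m')"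
      by (auto simp: weak_step_def taus_answerer step_answerer taus_tally act_defs)
    then have eq: "al q * n + ga q = be q k * m' + de q k"
      by (rule weak_bisim_tally) (use al ga be de q k in auto)
    \<comment> \<open>The attacker switches sides here: the guessed \<open>m'\<close> becomes the
      held value, and the old value \<open>n\<close> dissolves into a
      \<open>Guesser\<close>.\<close>
    have "step net (code (Answerer q k), m') (pick_act k) (code (Holder (nx q k)), m')"
      using q k by (auto simp: step_answerer reply_def)
    then obtain Q2 where "weak_step net (code (Asker q), n) (pick_act k) Q2"
      and Q2: "weak_bisim net (code (Holder (nx q k)), m') Q2"
      by (rule weak_bisim_step[OF weak_bisim_sym[OF bis']])
    then obtain n' where "Q2 = (code (Guesser (nx q k)), n')"
      using q k nx by (auto simp: weak_step_def taus_asker step_asker taus_guesser_iff act_defs)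
    then show ?case
      using Q2 k eq nx[OF q k] by blast
  qed
qed

end

section \<open>Register machines as affine systems\<close>

definition nth_prime :: "nat \<Rightarrow> nat" where
  "nth_prime r = enumerate {p. prime p} r"

lemma prime_nth_prime: "prime (nth_prime r)"
  unfolding nth_prime_def using enumerate_in_set[OF primes_infinite] by blast

lemma nth_prime_gt_1: "1 < nth_prime r"
  using prime_nth_prime prime_gt_1_nat by blast

lemma nth_prime_pos: "0 < nth_prime r"
  using nth_prime_gt_1[of r] by simp

lemma nth_prime_eq_iff: "nth_prime r = nth_prime r' \<longleftrightarrow> r = r'"
  unfolding nth_prime_def using strict_mono_enumerate[OF primes_infinite]
  by (simp add: strict_mono_eq)

lemma nth_prime_0: "nth_prime 0 = 2"
  unfolding nth_prime_def enumerate_0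
  by (rule Least_equality) (auto simp: prime_ge_2_nat)

definition godel :: "nat \<Rightarrow> (nat \<Rightarrow> nat) \<Rightarrow> nat" where
  "godel R s = (\<Prod>r<R. nth_prime r ^ s r)"

lemma godel_upd:
  assumes "r < R"
  shows "godel R (s(r := Suc (s r))) = nth_prime r * godel R s"
proof -
  have "godel R (s(r := v)) = nth_prime r ^ v * (\<Prod>i\<in>{..<R} - {r}. nth_prime i ^ s i)" for v
    unfolding godel_def using assms by (subst prod.remove[of _ r]) (auto intro!: prod.cong)
  from this[of "Suc (s r)"] this[of "s r"] show ?thesis
    by simp
qed

lemma nth_prime_dvd_godel:
  assumes "r < R"
  shows "nth_prime r dvd godel R s \<longleftrightarrow> 0 < s r"
proof
  assume "nth_prime r dvd godel R s"
  then obtain i where i: "i < R" "nth_prime r dvd nth_prime i ^ s i"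
    unfolding godel_def by (auto simp: prime_dvd_prod_iff prime_nth_prime)
  then have "nth_prime r dvd nth_prime i"
    using prime_dvd_power prime_nth_prime by blast
  then have "r = i"
    using prime_nth_prime primes_dvd_imp_eq nth_prime_eq_iff by blast
  with i show "0 < s r"
    using nth_prime_gt_1[of r] by (cases "s r") auto
next
  assume "0 < s r"
  then have "godel R s = nth_prime r * godel R (s(r := s r - 1))"
    using godel_upd[OF assms, of "s(r := s r - 1)"] by simp
  then show "nth_prime r dvd godel R s"
    by simp
qed

definition input :: "nat \<Rightarrow> nat \<Rightarrow> nat" where
  "input x = (\<lambda>r. if r = 0 then x else 0)"

lemma godel_input: "0 < R \<Longrightarrow> godel R (input x) = 2 ^ x"
  unfolding godel_def input_def by (subst prod.remove[of _ 0]) (auto simp: nth_prime_0)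

definition halts :: "instr list \<Rightarrow> config \<Rightarrow> bool" where
  "halts M c \<longleftrightarrow> (\<exists>k. halted M ((mstep M ^^ k) c))"

lemma halts_mstep: "halts M (mstep M c) \<Longrightarrow> halts M c"
  unfolding halts_def by (metis funpow_Suc_right comp_apply)

fun reg :: "instr \<Rightarrow> nat" where
  "reg (Inc r l) = r"
| "reg (Dec r l1 l2) = r"

lemma mstep_Inc: "pc < length M \<Longrightarrow> M ! pc = Inc r l \<Longrightarrow> mstep M (pc, s) = (l, s(r := Suc (s r)))"
  and mstep_Dec: "pc < length M \<Longrightarrow> M ! pc = Dec r l1 l2 \<Longrightarrow>
    mstep M (pc, s) = (if s r > 0 then (l1, s(r := s r - 1)) else (l2, s))"
  by (auto simp: mstep_def)

text \<open>\<open>R\<close> bounds the registers in use. \<open>B\<close> exceeds their primes, so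
  every remainder is below \<open>B\<close>, the node \<open>pc * B + i\<close> decodes uniquely,
  and all coefficients are at most \<open>B\<close>.\<close>

locale machine_coding =
  fixes M :: "instr list" and R B :: nat
  assumes B_gt_1: "1 < B" and R_pos: "0 < R"
    and regs: "ins \<in> set M \<Longrightarrow> reg ins < R \<and> nth_prime (reg ins) < B"
begin

text \<open>Node \<open>pc * B\<close> stands for instruction \<open>pc\<close>. An instruction \<open>Dec r l1 l2\<close> divides the Goedel
number by the prime \<open>p\<close> of \<open>r\<close>; a remainder \<open>i > 0\<close> means that \<open>r\<close> is zero, and node \<open>pc * B + i\<close>
then restores the Goedel number as \<open>p * n + i\<close>.\<close>

definition m_al :: "nat \<Rightarrow> nat" where
  "m_al x = (if x div B < length M then case M ! (x div B) of
      Inc r l \<Rightarrow> nth_prime r | Dec r l1 l2 \<Rightarrow> if x mod B = 0 then 1 else nth_prime r else 1)"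

definition m_ga :: "nat \<Rightarrow> nat" where
  "m_ga x = x mod B"

text \<open>With \<open>p\<close> the prime of the register, the equations are
  \<open>p * n = m\<close> for \<open>Inc\<close>, \<open>n = p * m + k\<close> for
  \<open>Dec\<close> at its main node (one successor per remainder \<open>k\<close>), and
  \<open>p * n + i = m\<close> at its node with remainder \<open>i\<close>. Past the last
  instruction there is no successor, so halting ends the run.\<close>

definition m_w :: "nat \<Rightarrow> nat" where
  "m_w x = (if x div B < length M then case M ! (x div B) of
      Inc r l \<Rightarrow> 1 | Dec r l1 l2 \<Rightarrow> if x mod B = 0 then nth_prime r else 1 else 0)"

definition m_be :: "nat \<Rightarrow> nat \<Rightarrow> nat" where
  "m_be x k = (case M ! (x div B) of
      Inc r l \<Rightarrow> 1 | Dec r l1 l2 \<Rightarrow> if x mod B = 0 then nth_prime r else 1)"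

definition m_de :: "nat \<Rightarrow> nat \<Rightarrow> nat" where
  "m_de x k = k"

text \<open>All jumps out of the program are cut to the single address \<open>length M\<close>,
  which keeps the system finite.\<close>

definition node :: "nat \<Rightarrow> nat" where
  "node l = min l (length M) * B"

definition m_nx :: "nat \<Rightarrow> nat \<Rightarrow> nat" where
  "m_nx x k = (case M ! (x div B) of
      Inc r l \<Rightarrow> node l
    | Dec r l1 l2 \<Rightarrow> if x mod B \<noteq> 0 then node l2 else if k = 0 then node l1 else x + k)"

lemma node_less: "node l < Suc (length M) * B"
  unfolding node_def using B_gt_1 by (intro mult_strict_right_mono) auto

lemma regs_nth: "pc < length M \<Longrightarrow> reg (M ! pc) < R \<and> nth_prime (reg (M ! pc)) < B"
  using regs nth_mem by blast

sublocale affine_system m_al m_ga m_w m_be m_de m_nx "Suc (length M) * B" B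
proof
  show "0 < B"
    using B_gt_1 by simp
  fix x
  show "0 < m_al x \<and> m_al x \<le> B"
    using B_gt_1 regs_nth[of "x div B"]
    by (auto simp: m_al_def nth_prime_pos split: instr.splits)
  show "m_ga x \<le> B"
    using B_gt_1 by (simp add: m_ga_def order.strict_implies_order)
  fix k
  assume k: "k < m_w x"
  then have pc: "x div B < length M"
    by (auto simp: m_w_def split: if_splits)
  show "0 < m_be x k \<and> m_be x k \<le> B"
    using B_gt_1 regs_nth[OF pc]
    by (auto simp: m_be_def nth_prime_pos split: instr.splits)
  show "m_de x k \<le> B"
    using k B_gt_1 regs_nth[OF pc] by (auto simp: m_w_def m_de_def split: if_splits instr.splits)
  \<comment> \<open>A remainder is below \<open>B\<close>, so \<open>x + k\<close> stays within the
    block of \<open>B\<close> nodes of the same instruction.\<close>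
  have "x + k < Suc (length M) * B" if "M ! (x div B) = Dec r l1 l2" "x mod B = 0"
    for r l1 l2
  proof -
    have "k < B"
      using k that regs_nth[OF pc] by (auto simp: m_w_def split: if_splits)
    moreover have "x = x div B * B"
      using that by auto
    moreover have "x div B * B \<le> length M * B"
      using pc by (intro mult_right_mono) auto
    ultimately show ?thesis
      by simp
  qed
  then show "m_nx x k < Suc (length M) * B"
    using node_less by (auto simp: m_nx_def split: instr.splits)
qed

lemmas m_defs = m_al_def m_ga_def m_w_def m_be_def m_de_def m_nx_def

section \<open>Infinite affine runs correspond to non-halting computations\<close>

abbreviation survives_config :: "config \<Rightarrow> bool" where
  "survives_config c \<equiv> survives (node (fst c)) (godel R (snd c))"

lemma node_div_mod: "pc < length M \<Longrightarrow> node pc div B = pc \<and> node pc mod B = 0"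
  using B_gt_1 by (simp add: node_def)

lemma survives_config_not_halted:
  assumes "survives_config c" shows "\<not> halted M c"
proof
  assume "halted M c"
  then have "node (fst c) div B = length M"
    using B_gt_1 by (simp add: node_def halted_def)
  with assms show False
    by (cases rule: survives.cases) (simp add: m_w_def)
qed

text \<open>The run has no real choice: at \<open>Dec\<close>, \<open>k\<close> must be the
  remainder of the Goedel number modulo the prime, which is 0 iff the register is positive. One
  machine step thus takes one step of the run, or two when a \<open>Dec\<close> finds zero.\<close>

lemma survives_config_mstep:
  assumes "survives_config c" shows "survives_config (mstep M c)"
proof -
  obtain pc s where c: "c = (pc, s)"
    by fastforce
  with survives_config_not_halted[OF assms] have pc: "pc < length M"
    by (simp add: halted_def)
  note [simp] = node_div_mod[OF pc]
  from assms obtain k m where k: "k < m_w (node pc)"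
    and eq: "m_al (node pc) * godel R s + m_ga (node pc) = m_be (node pc) k * m + m_de (node pc) k"
    and surv: "survives (m_nx (node pc) k) m"
    unfolding c by (cases rule: survives.cases) auto
  show ?thesis
  proof (cases "M ! pc")
    case (Inc r l)
    with pc k eq surv regs_nth[OF pc] show ?thesis
      by (simp add: c m_defs mstep_Inc godel_upd)
  next
    case (Dec r l1 l2)
    then have r: "r < R" and p: "nth_prime r < B" and k: "k < nth_prime r"
      and eq: "godel R s = nth_prime r * m + k"
      using regs_nth[OF pc] pc k eq by (simp_all add: m_defs)
    show ?thesis
    proof (cases "0 < s r")
      case True
      then have "k = 0"
        using nth_prime_dvd_godel[OF r, of s] eq k by (auto simp: dvd_add_right_iff dest: dvd_imp_le)
      moreover have "godel R s = nth_prime r * godel R (s(r := s r - 1))"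
        using godel_upd[OF r, of "s(r := s r - 1)"] True by simp
      ultimately have "m = godel R (s(r := s r - 1))"
        using eq nth_prime_gt_1[of r] by simp
      then show ?thesis
        using True surv Dec pc \<open>k = 0\<close> by (simp add: c m_nx_def mstep_Dec)
    next
      case False
      then have "k \<noteq> 0"
        using nth_prime_dvd_godel[OF r, of s] eq by (intro notI) simp
      have x: "(node pc + k) div B = pc" "(node pc + k) mod B = k"
        using pc p k B_gt_1 by (simp_all add: node_def)
      have "survives (node pc + k) m"
        using surv Dec \<open>k \<noteq> 0\<close> by (simp add: m_nx_def)
      then have "survives (node l2) (nth_prime r * m + k)"
        by (cases rule: survives.cases) (use x pc Dec \<open>k \<noteq> 0\<close> in \<open>simp add: m_defs\<close>)
      then show ?thesis
        using False Dec pc eq by (simp add: c mstep_Dec)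
    qed
  qed
qed

lemma survives_config_imp_not_halts:
  assumes "survives_config c" shows "\<not> halts M c"
proof -
  have "survives_config ((mstep M ^^ k) c)" for k
    by (induction k) (use assms survives_config_mstep in auto)
  then show ?thesis
    unfolding halts_def using survives_config_not_halted by blast
qed

lemma not_halts_imp_survives_config:
  assumes "\<not> halts M c" shows "survives_config c"
proof -
  \<comment> \<open>Besides the main nodes, the invariant covers the intermediate nodes of a
    \<open>Dec\<close> on zero, where the value is the quotient and \<open>s\<close> still describes
    the unchanged registers.\<close>
  define inv where "inv x n \<longleftrightarrow> (\<exists>pc s. \<not> halts M (pc, s) \<and>
      (x = node pc \<and> n = godel R s \<or>
       (\<exists>r l1 l2 i. pc < length M \<and> M ! pc = Dec r l1 l2 \<and> s r = 0 \<and> 0 < i \<and> i < nth_prime r \<and>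
          x = node pc + i \<and> godel R s = nth_prime r * n + i)))" for x n
  have "survives x n" if "inv x n" for x n
    using that
  proof (coinduction arbitrary: x n)
    case survives
    then obtain pc s where nh: "\<not> halts M (pc, s)" and cases:
      "x = node pc \<and> n = godel R s \<or>
       (\<exists>r l1 l2 i. pc < length M \<and> M ! pc = Dec r l1 l2 \<and> s r = 0 \<and> 0 < i \<and> i < nth_prime r \<and>
          x = node pc + i \<and> godel R s = nth_prime r * n + i)"
      unfolding inv_def by blast
    have pc: "pc < length M"
      using nh unfolding halts_def halted_def by (metis fst_conv funpow_0 not_le)
    note [simp] = node_div_mod[OF pc]
    have nh': "\<not> halts M (mstep M (pc, s))"
      using nh halts_mstep by blast
    have "\<exists>k m. k < m_w x \<and> m_al x * n + m_ga x = m_be x k * m + m_de x k \<and> inv (m_nx x k) m"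
      using cases
    proof (elim disjE exE conjE)
      assume x: "x = node pc" "n = godel R s"
      show ?thesis
      proof (cases "M ! pc")
        case (Inc r l)
        with nh' pc have "inv (node l) (godel R (s(r := Suc (s r))))"
          unfolding inv_def by (auto simp: mstep_Inc)
        then show ?thesis
          using x Inc pc regs_nth[OF pc]
          by (intro exI[of _ 0] exI[of _ "godel R (s(r := Suc (s r)))"]) (simp add: m_defs godel_upd)
      next
        case (Dec r l1 l2)
        then have r: "r < R"
          using regs_nth[OF pc] by simp
        show ?thesis
        proof (cases "0 < s r")
          case True
          then have "inv (node l1) (godel R (s(r := s r - 1)))"
            using nh' pc Dec unfolding inv_def by (auto simp: mstep_Dec)
          moreover have "godel R s = nth_prime r * godel R (s(r := s r - 1))"
            using godel_upd[OF r, of "s(r := s r - 1)"] True by simp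
          ultimately show ?thesis
            using x Dec pc nth_prime_gt_1[of r]
            by (intro exI[of _ 0] exI[of _ "godel R (s(r := s r - 1))"]) (simp add: m_defs)
        next
          case False
          \<comment> \<open>The answer is honest division: the remainder is positive because the
            prime of an empty register does not divide the Goedel number.\<close>
          define i where "i = godel R s mod nth_prime r"
          have i: "0 < i" "i < nth_prime r"
            unfolding i_def using nth_prime_dvd_godel[OF r, of s] False nth_prime_gt_1[of r]
            by (auto simp: dvd_eq_mod_eq_0)
          have eq: "godel R s = nth_prime r * (godel R s div nth_prime r) + i"
            unfolding i_def by simp
          have "inv (node pc + i) (godel R s div nth_prime r)"
            unfolding inv_def using nh pc Dec False i eq by blast
          then show ?thesis
            using x Dec pc i eq
            by (intro exI[of _ i] exI[of _ "godel R s div nth_prime r"]) (simp add: m_defs)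
        qed
      qed
    next
      fix r l1 l2 i
      assume Dec: "M ! pc = Dec r l1 l2" and i: "s r = 0" "0 < i" "i < nth_prime r"
        and x: "x = node pc + i" "godel R s = nth_prime r * n + i"
      have "x div B = pc" "x mod B = i"
        using pc i x regs_nth[OF pc] Dec B_gt_1 by (simp_all add: node_def)
      moreover have "inv (node l2) (godel R s)"
        using nh' pc Dec i unfolding inv_def by (auto simp: mstep_Dec)
      ultimately show ?thesis
        using x Dec pc i
        by (intro exI[of _ 0] exI[of _ "godel R s"]) (simp add: m_defs)
    qed
    then show ?case
      by blast
  qed
  moreover have "inv (node (fst c)) (godel R (snd c))"
    using assms unfolding inv_def by (metis prod.collapse)
  ultimately show ?thesis
    by blast
qed

end

text \<open>The first process is \<open>Holder 0\<close> with the Goedel number of the input, the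
  second is \<open>Guesser 0\<close>. One net must serve all \<open>x\<close>, since
  \<open>x\<close> will later be the code of that very net.\<close>

lemma machine_net:
  "\<exists>N. \<forall>x. valid_instance N (0, 2 ^ x) (2, 0) \<and>
     (halts M (0, input x) \<longrightarrow> \<not> weak_bisim N (0, 2 ^ x) (2, 0)) \<and>
     (\<not> halts M (0, input x) \<longrightarrow> branching_bisim N (0, 2 ^ x) (2, 0))"
proof -
  have "finite (reg ` set M \<union> (nth_prime \<circ> reg) ` set M)"
    by simp
  then obtain b0 where b0: "\<forall>y\<in>reg ` set M \<union> (nth_prime \<circ> reg) ` set M. y < b0"
    using finite_nat_set_iff_bounded by blast
  \<comment> \<open>One bound serves as both \<open>R\<close> and \<open>B\<close>; adding 2 ensures
    \<open>1 < B\<close> and \<open>0 < R\<close>.\<close>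
  define b where "b = b0 + 2"
  interpret machine_coding M b b
    by unfold_locales (use b0 in \<open>auto simp: b_def ball_Un less_SucI\<close>)
  have codes: "code (Holder 0) = 0" "code (Guesser 0) = 2"
    by (simp_all add: code.simps prod_encode_def triangle_def)
  have node: "node 0 = 0" "0 < Suc (length M) * b"
    using R_pos by (simp_all add: node_def)
  show ?thesis
  proof (intro exI[of _ net] allI conjI impI)
    show "valid_instance net (0, 2 ^ x) (2, 0)" for x
      unfolding valid_instance_def is_process_def
      using wf_net normed_net states_net(1,2)[of 0] node codes by auto
    show "\<not> weak_bisim net (0, 2 ^ x) (2, 0)" if "halts M (0, input x)" for x
      using that survives_config_imp_not_halts[of "(0, input x)"]
        weak_bisim_imp_survives[of 0 "2 ^ x" 0] node codes godel_input[OF R_pos, of x] by auto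
    show "branching_bisim net (0, 2 ^ x) (2, 0)" if "\<not> halts M (0, input x)" for x
      using not_halts_imp_survives_config[OF that] survives_imp_branching_bisim[of 0 "2 ^ x" 0]
        node codes godel_input[OF R_pos, of x] by auto
  qed
qed

section \<open>The diagonal machine\<close>

definition reaches :: "instr list \<Rightarrow> config \<Rightarrow> config \<Rightarrow> bool" where
  "reaches M c c' \<longleftrightarrow> (\<exists>k. (mstep M ^^ k) c = c')"

lemma reaches_refl: "reaches M c c"
  unfolding reaches_def by (metis funpow_0)

lemma reaches_trans [trans]: "reaches M c c' \<Longrightarrow> reaches M c' c'' \<Longrightarrow> reaches M c c''"
  unfolding reaches_def by (metis funpow_add comp_apply)

lemma reaches_mstep: "reaches M (mstep M c) c' \<Longrightarrow> reaches M c c'"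
  unfolding reaches_def by (metis funpow_Suc_right comp_apply)

datatype com = Incr nat | Clear nat | Seq com com (infixr ";;" 60) | Loop nat com

fun writes :: "com \<Rightarrow> nat set" where
  "writes (Incr r) = {r}"
| "writes (Clear r) = {r}"
| "writes (c ;; d) = writes c \<union> writes d"
| "writes (Loop r c) = insert r (writes c)"

fun well_formed :: "com \<Rightarrow> bool" where
  "well_formed (Incr r) = True"
| "well_formed (Clear r) = True"
| "well_formed (c ;; d) = (well_formed c \<and> well_formed d)"
| "well_formed (Loop r c) = (well_formed c \<and> r \<notin> writes c)"

text \<open>The equation for \<open>Loop r c\<close> agrees with a while loop only if \<open>c\<close> does not write \<open>r\<close>.\<close>

fun run :: "com \<Rightarrow> (nat \<Rightarrow> nat) \<Rightarrow> nat \<Rightarrow> nat" where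
  "run (Incr r) s = s(r := Suc (s r))"
| "run (Clear r) s = s(r := 0)"
| "run (c ;; d) s = run d (run c s)"
| "run (Loop r c) s = ((\<lambda>s. run c (s(r := s r - 1))) ^^ s r) s"

fun len :: "com \<Rightarrow> nat" where
  "len (Incr r) = 1"
| "len (Clear r) = 1"
| "len (c ;; d) = len c + len d"
| "len (Loop r c) = Suc (len c)"

text \<open>\<open>compile c a e\<close> is code to be placed at address \<open>a\<close> that exits to address \<open>e\<close>.\<close>

fun compile :: "com \<Rightarrow> nat \<Rightarrow> nat \<Rightarrow> instr list" where
  "compile (Incr r) a e = [Inc r e]"
| "compile (Clear r) a e = [Dec r a e]"
| "compile (c ;; d) a e = compile c a (a + len c) @ compile d (a + len c) e"
| "compile (Loop r c) a e = Dec r (Suc a) e # compile c (Suc a) a"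

lemma length_compile [simp]: "length (compile c a e) = len c"
  by (induction c arbitrary: a e) auto

lemma run_not_writes: "r \<notin> writes c \<Longrightarrow> run c s r = s r"
proof (induction c arbitrary: s)
  case (Loop q c)
  have "((\<lambda>s. run c (s(q := s q - 1))) ^^ k) s r = s r" for k
    by (induction k) (use Loop in auto)
  then show ?case
    by simp
qed auto

definition code_at :: "instr list \<Rightarrow> nat \<Rightarrow> instr list \<Rightarrow> bool" where
  "code_at M a p \<longleftrightarrow> (\<forall>i<length p. a + i < length M \<and> M ! (a + i) = p ! i)"

lemma code_at_append: "code_at M a (p @ q) \<longleftrightarrow> code_at M a p \<and> code_at M (a + length p) q"
proof -
  have "code_at M a (p @ q) \<longleftrightarrow> (\<forall>i<length p. a + i < length M \<and> M ! (a + i) = p ! i) \<and>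
      (\<forall>i<length q. a + (length p + i) < length M \<and> M ! (a + (length p + i)) = q ! i)"
    unfolding code_at_def length_append
    by (auto simp: nth_append split: if_splits)
      (metis le_add_diff_inverse nat_add_left_cancel_less not_le)+
  then show ?thesis
    unfolding code_at_def by (simp add: add.assoc)
qed

lemma code_at_Cons: "code_at M a (ins # q) \<longleftrightarrow> a < length M \<and> M ! a = ins \<and> code_at M (Suc a) q"
  using code_at_append[of M a "[ins]" q] by (simp add: code_at_def)

text \<open>Induction on the program; \<open>Clear\<close> and \<open>Loop\<close> need an inner
  induction on the register that counts the remaining passes.\<close>

lemma reaches_compile:
  assumes "code_at M a (compile c a e)" "well_formed c"
  shows "reaches M (a, s) (e, run c s)"
  using assms
proof (induction c arbitrary: a e s)
  case (Incr r)
  show ?case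
    by (rule reaches_mstep) (use Incr in \<open>simp add: code_at_Cons mstep_def reaches_refl del: fun_upd_apply\<close>)
next
  case (Clear r)
  show ?case
  proof (induction "s r" arbitrary: s)
    case 0
    then have "s(r := 0) = s"
      by auto
    then show ?case
      using reaches_refl 0 Clear by (intro reaches_mstep[of M "(a, s)"]) (simp add: code_at_Cons mstep_def)
  next
    case (Suc k)
    have "reaches M (a, s(r := k)) (e, run (Clear r) (s(r := k)))"
      by (rule Suc(1)) simp
    then show ?case
      by (intro reaches_mstep[of M "(a, s)"])
        (use Suc(2)[symmetric] Clear in \<open>simp add: code_at_Cons mstep_def\<close>)
  qed
next
  case (Seq c d)
  then have "reaches M (a, s) (a + len c, run c s)"
    "reaches M (a + len c, run c s) (e, run d (run c s))"
    by (simp_all add: code_at_append)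
  then show ?case
    by (simp add: reaches_trans)
next
  case (Loop r c)
  show ?case
  proof (induction "s r" arbitrary: s)
    case 0
    show ?case
      by (rule reaches_mstep) (use 0 Loop(2) in \<open>simp add: code_at_Cons mstep_def reaches_refl\<close>)
  next
    case (Suc k)
    define s' where "s' = run c (s(r := k))"
    have "reaches M (Suc a, s(r := k)) (a, s')"
      unfolding s'_def using Loop by (simp add: code_at_Cons)
    \<comment> \<open>Here \<open>well_formed\<close> enters: the body preserves \<open>r\<close>,
      so the inner induction hypothesis applies to the state after one pass.\<close>
    also have "s' r = k"
      unfolding s'_def using Loop(3) by (simp add: run_not_writes)
    then have "reaches M (a, s') (e, run (Loop r c) s')"
      by (intro Suc(1)) simp
    also have "run (Loop r c) s' = run (Loop r c) s"
      using \<open>s' r = k\<close> Suc(2)[symmetric] by (simp add: s'_def funpow_Suc_right del: funpow.simps)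
    finally have "reaches M (Suc a, s(r := k)) (e, run (Loop r c) s)" .
    then show ?case
      by (intro reaches_mstep[of M "(a, s)"])
        (use Suc(2)[symmetric] Loop(2) in \<open>simp add: code_at_Cons mstep_def del: run.simps\<close>)
  qed
qed

section \<open>Arithmetic programs that build the instance\<close>

lemma run_Loop_0: "s r = 0 \<Longrightarrow> run (Loop r c) s = s"
  by simp

lemma run_Loop_Suc: "s r = Suc k \<Longrightarrow> r \<notin> writes c \<Longrightarrow>
    run (Loop r c) s = run (Loop r c) (run c (s(r := k)))"
  by (simp add: funpow_Suc_right run_not_writes del: funpow.simps)

lemma run_move2:
  assumes "a \<noteq> b" "a \<noteq> c" "b \<noteq> c"
  shows "run (Loop a (Incr b ;; Incr c)) s = s(a := 0, b := s b + s a, c := s c + s a)"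
proof (induction "s a" arbitrary: s)
  case 0
  then show ?case by (auto simp: run_Loop_0 simp del: run.simps)
next
  case (Suc k)
  have "run (Loop a (Incr b ;; Incr c)) s = run (Loop a (Incr b ;; Incr c)) (s(a := k, b := Suc (s b), c := Suc (s c)))"
    using run_Loop_Suc[of s a k "Incr b ;; Incr c"] Suc(2) assms by (simp add: fun_upd_twist del: run.simps(4))
  with Suc(1)[of "s(a := k, b := Suc (s b), c := Suc (s c))"] Suc(2)[symmetric] assms show ?case
    by (auto simp: fun_eq_iff simp del: run.simps)
qed

lemma run_move:
  assumes "a \<noteq> b"
  shows "run (Loop a (Incr b)) s = s(a := 0, b := s b + s a)"
proof (induction "s a" arbitrary: s)
  case 0
  then show ?case by (auto simp: run_Loop_0 simp del: run.simps)
next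
  case (Suc k)
  have "run (Loop a (Incr b)) s = run (Loop a (Incr b)) (s(a := k, b := Suc (s b)))"
    using run_Loop_Suc[of s a k "Incr b"] Suc(2) assms by (simp del: run.simps(4))
  with Suc(1)[of "s(a := k, b := Suc (s b))"] Suc(2)[symmetric] assms show ?case
    by (auto simp: fun_eq_iff simp del: run.simps)
qed

text \<open>A loop may not write its own counter, so register 1 is emptied into two scratch
  registers that are both poured back.\<close>

definition double :: com where
  "double = Loop 1 (Incr 4 ;; Incr 7) ;; Loop 4 (Incr 1) ;; Loop 7 (Incr 1)"

lemma writes_double: "writes double = {1, 4, 7}"
  by (auto simp: double_def)

lemma run_double: "s 4 = 0 \<Longrightarrow> s 7 = 0 \<Longrightarrow> run double s = s(1 := 2 * s 1)"
  by (simp add: double_def run_move run_move2 fun_eq_iff del: run.simps(4))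

lemma run_power:
  "s 4 = 0 \<Longrightarrow> s 7 = 0 \<Longrightarrow> run (Loop 2 double) s = s(2 := 0, 1 := s 1 * 2 ^ s 2)"
proof (induction "s 2" arbitrary: s)
  case 0
  then show ?case
    by (auto simp: run_Loop_0 simp del: run.simps)
next
  case (Suc k)
  have "run (Loop 2 double) s = run (Loop 2 double) (s(2 := k, 1 := 2 * s 1))"
    using run_Loop_Suc[of s 2 k double] Suc(2-4)
    by (simp add: run_double writes_double del: run.simps)
  with Suc(1)[of "s(2 := k, 1 := 2 * s 1)"] Suc(2)[symmetric] Suc(3,4) show ?case
    by (auto simp: fun_eq_iff simp del: run.simps)
qed

text \<open>Register 5 runs through 1, 2, 3, ... and is added to \<open>c\<close> in each pass,
  register 6 serving to restore it. Triangular numbers are what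
  \<open>prod_encode (m, n) = triangle (m + n) + m\<close> requires.\<close>

definition add_triangle :: "nat \<Rightarrow> com" where
  "add_triangle c = Loop 1 (Incr 5 ;; Loop 5 (Incr c ;; Incr 6) ;; Loop 6 (Incr 5)) ;; Clear 5"

lemma run_add_triangle:
  assumes c: "c \<notin> {1, 5, 6}" and "s 5 = 0" "s 6 = 0"
  shows "run (add_triangle c) s = s(1 := 0, c := s c + triangle (s 1))"
proof -
  let ?body = "Incr 5 ;; Loop 5 (Incr c ;; Incr 6) ;; Loop 6 (Incr 5)"
  \<comment> \<open>Generalised to an arbitrary start value of register 5, which grows from pass to
    pass.\<close>
  have "run (Loop 1 ?body) s = s(1 := 0, 5 := s 5 + s 1, c := s c + s 1 * s 5 + triangle (s 1))"
    if "s 6 = 0" for s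
    using that
  proof (induction "s 1" arbitrary: s)
    case 0
    then show ?case
      by (auto simp: run_Loop_0 simp del: run.simps)
  next
    case (Suc k)
    let ?s = "s(1 := k, 5 := Suc (s 5), c := s c + Suc (s 5))"
    have "run ?body (s(1 := k)) = ?s"
      using c Suc(3) by (auto simp: run_move run_move2 fun_eq_iff simp del: run.simps(4))
    then have "run (Loop 1 ?body) s = run (Loop 1 ?body) ?s"
      using run_Loop_Suc[of s 1 k ?body] Suc(2) c by (simp del: run.simps)
    with Suc(1)[of ?s] Suc(2)[symmetric] Suc(3) c show ?case
      by (auto simp: fun_eq_iff simp del: run.simps)
  qed
  with assms show ?thesis
    by (auto simp: add_triangle_def fun_eq_iff simp del: run.simps(4))
qed

text \<open>The constants 0 and 2 are \<open>code (Holder 0)\<close> and \<open>code (Guesser 0)\<close>.\<close>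

definition self_instance :: "nat \<Rightarrow> nat" where
  "self_instance x = prod_encode (x, prod_encode (prod_encode (0, 2 ^ x), prod_encode (2, 0)))"

text \<open>Each \<open>add_triangle\<close> computes one pair, with \<open>m + n\<close> in
  register 1 and \<open>m\<close> already in the target: first
  \<open>prod_encode (0, 2 ^ x)\<close>, then its pair with 5, which is
  \<open>prod_encode (2, 0)\<close>, and finally the pair of \<open>x\<close>, saved in register 3,
  with that result.\<close>

definition make_instance :: com where
  "make_instance =
     Loop 0 (Incr 2 ;; Incr 3) ;; Incr 1 ;; Loop 2 double ;; add_triangle 4 ;;
     Loop 4 (Incr 1 ;; Incr 2) ;; Incr 1 ;; Incr 1 ;; Incr 1 ;; Incr 1 ;; Incr 1 ;; add_triangle 2 ;;
     Loop 2 (Incr 1) ;; Loop 3 (Incr 1 ;; Incr 2) ;; add_triangle 2 ;; Loop 2 (Incr 0)"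

lemma run_make_instance: "run make_instance (input x) = input (self_instance x)"
proof -
  have "prod_encode (m, n) = triangle (m + n) + m" "triangle 2 = 3" for m n
    by (simp_all add: prod_encode_def triangle_def)
  then show ?thesis
    by (simp add: make_instance_def run_move run_move2 run_power run_add_triangle input_def
        self_instance_def ac_simps fun_eq_iff del: run.simps(4))
qed

lemma well_formed_make_instance: "well_formed make_instance"
  by (simp add: make_instance_def double_def add_triangle_def)

section \<open>Relocated code and the diagonal machine\<close>

fun relocate :: "nat \<Rightarrow> nat \<Rightarrow> instr \<Rightarrow> instr" where
  "relocate a n (Inc r l) = Inc r (a + min l n)"
| "relocate a n (Dec r l1 l2) = Dec r (a + min l1 n) (a + min l2 n)"

text \<open>Cutting jump targets at \<open>length M\<close> sends every exit of \<open>M\<close> to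
  the one address just behind its copy. Halted configurations are fixed by \<open>mstep\<close>, so
  there the copy can stand still.\<close>

lemma reaches_relocate:
  assumes "code_at D a (map (relocate a (length M)) M)"
  shows "reaches D (a + min (fst c) (length M), snd c)
    (a + min (fst ((mstep M ^^ k) c)) (length M), snd ((mstep M ^^ k) c))"
proof (induction k)
  case 0
  then show ?case
    by (simp add: reaches_refl)
next
  case (Suc k)
  obtain pc s where c: "(mstep M ^^ k) c = (pc, s)"
    by fastforce
  have "reaches D (a + min pc (length M), s)
      (a + min (fst (mstep M (pc, s))) (length M), snd (mstep M (pc, s)))"
  proof (cases "pc < length M")
    case True
    then have "a + pc < length D" "D ! (a + pc) = relocate a (length M) (M ! pc)"
      using assms unfolding code_at_def by auto
    with True show ?thesis
      by (intro reaches_mstep[of D "(a + min pc (length M), s)"])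
        (cases "M ! pc"; simp add: mstep_def reaches_refl)
  next
    case False
    then show ?thesis
      by (simp add: mstep_def reaches_refl)
  qed
  with Suc show ?case
    by (auto simp: c intro: reaches_trans)
qed

text \<open>The machine is deterministic and halted configurations stay halted, so a step changes
  halting in neither direction.\<close>

lemma reaches_halts:
  assumes "reaches M c c'" shows "halts M c \<longleftrightarrow> halts M c'"
proof -
  have step: "halts M (mstep M c) \<longleftrightarrow> halts M c" for c
  proof
    assume "halts M c"
    then obtain k where k: "halted M ((mstep M ^^ k) c)"
      unfolding halts_def by blast
    then have "halted M (mstep M ((mstep M ^^ k) c))"
      by (auto simp: halted_def mstep_def split: prod.splits)
    then show "halts M (mstep M c)"
      unfolding halts_def by (metis funpow_swap1)
  qed (rule halts_mstep)
  obtain k where "c' = (mstep M ^^ k) c"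
    using assms unfolding reaches_def by blast
  then show ?thesis
    by (induction k arbitrary: c') (auto simp: step)
qed

text \<open>The final \<open>Dec\<close> inverts the answer: on 0 it jumps to itself forever, on 1
  it leaves the program and halts.\<close>

definition diagonal :: "instr list \<Rightarrow> instr list" where
  "diagonal M = (let a = len make_instance; e = a + length M in
     compile make_instance 0 a @ map (relocate a (length M)) M @ [Dec 0 (Suc e) e])"

lemma diagonal_halts_iff:
  assumes "computes M (self_instance x) v" "v \<le> 1"
  shows "halts (diagonal M) (0, input x) \<longleftrightarrow> v = 1"
proof -
  define a where "a = len make_instance"
  define e where "e = a + length M"
  define D where "D = diagonal M"
  have len: "length D = Suc e"
    by (simp add: D_def diagonal_def e_def a_def Let_def)
  have D: "D = compile make_instance 0 a @ map (relocate a (length M)) M @ [Dec 0 (Suc e) e]"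
    by (simp add: D_def diagonal_def Let_def a_def e_def)
  have "code_at D 0 D"
    by (simp add: code_at_def)
  then have "code_at D 0 (compile make_instance 0 a @ map (relocate a (length M)) M @ [Dec 0 (Suc e) e])"
    by (simp only: D[symmetric])
  then have parts: "code_at D 0 (compile make_instance 0 a)"
      "code_at D a (map (relocate a (length M)) M)" "code_at D e [Dec 0 (Suc e) e]"
    by (simp_all add: code_at_append a_def e_def)
  obtain k where k: "halted M ((mstep M ^^ k) (0, input (self_instance x)))"
      "snd ((mstep M ^^ k) (0, input (self_instance x))) 0 = v"
    using assms(1) unfolding computes_def input_def by blast
  define s where "s = snd ((mstep M ^^ k) (0, input (self_instance x)))"
  have "reaches D (0, input x) (a, input (self_instance x))"
    using reaches_compile[OF parts(1) well_formed_make_instance, of "input x"]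
    by (simp add: run_make_instance)
  also have "reaches D (a, input (self_instance x)) (e, s)"
    using reaches_relocate[OF parts(2), of "(0, input (self_instance x))" k] k(1)
    by (simp add: halted_def s_def e_def)
  finally have "halts D (0, input x) \<longleftrightarrow> halts D (e, s)"
    by (rule reaches_halts)
  also have "\<dots> \<longleftrightarrow> v = 1"
  proof -
    have step: "mstep D (e, s) = (if s 0 > 0 then (Suc e, s(0 := s 0 - 1)) else (e, s))"
      using parts(3) by (simp add: code_at_Cons mstep_Dec)
    show ?thesis
    proof (cases "v = 1")
      case True
      then have "mstep D (e, s) = (Suc e, s(0 := s 0 - 1))"
        using step k(2) by (simp add: s_def)
      then have "halts D (mstep D (e, s))"
        unfolding halts_def using len by (intro exI[of _ 0]) (simp add: halted_def)
      then show ?thesis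
        using True halts_mstep by blast
    next
      case False
      then have "mstep D (e, s) = (e, s)"
        using step k(2) assms(2) by (simp add: s_def)
      then have "(mstep D ^^ n) (e, s) = (e, s)" for n
        by (induction n) auto
      then show ?thesis
        using False len by (simp add: halts_def halted_def)
    qed
  qed
  finally show ?thesis
    unfolding D_def .
qed

theorem theorem1:
  fixes R :: "ocn \<Rightarrow> proc \<Rightarrow> proc \<Rightarrow> bool"
  assumes "\<And>N P Q. branching_bisim N P Q \<Longrightarrow> R N P Q"
      and "\<And>N P Q. R N P Q \<Longrightarrow> weak_bisim N P Q"
  shows "\<not> decidable_on_normed_ocn R"
proof
  assume "decidable_on_normed_ocn R"
  then obtain M where M: "\<And>N P Q. valid_instance N P Q \<Longrightarrow>
      computes M (encode_instance N P Q) (if R N P Q then 1 else 0)"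
    unfolding decidable_on_normed_ocn_def by blast
  obtain N where N: "valid_instance N (0, 2 ^ x) (2, 0)"
    "halts (diagonal M) (0, input x) \<Longrightarrow> \<not> weak_bisim N (0, 2 ^ x) (2, 0)"
    "\<not> halts (diagonal M) (0, input x) \<Longrightarrow> branching_bisim N (0, 2 ^ x) (2, 0)" for x
    using machine_net[of "diagonal M"] by blast
  \<comment> \<open>Self-reference: for this \<open>x\<close>, \<open>self_instance x\<close>
    encodes the instance on the net of \<open>diagonal M\<close> itself.\<close>
  define x where "x = encode_ocn N"
  have "computes M (self_instance x) (if R N (0, 2 ^ x) (2, 0) then 1 else 0)"
    using M[OF N(1)[of x]] by (simp add: encode_instance_def self_instance_def x_def)
  from diagonal_halts_iff[OF this]
  have "halts (diagonal M) (0, input x) \<longleftrightarrow> R N (0, 2 ^ x) (2, 0)"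
    by (simp split: if_splits)
  \<comment> \<open>Halting would give \<open>R\<close> and refute weak bisimilarity; not halting
    would give branching bisimilarity, hence \<open>R\<close>, hence halting.\<close>
  then show False
    using N(2,3)[of x] assms by blast
qed

end
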